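(* For all integers $n\ge0$ the following polynomial identities in $s$ hold. The Fibonacci polynomials satisfy $$F_{2n+2}(s)=\sum_{k=0}^{n}(-1)^{n-k}\frac{G_{2n-2k+2}}{2k+1}\binom{2n+2}{2k}F_{2k+1}(s)$$ and $$F_{2n+1}(s)=\sum_{k=0}^{n}\binom{2n+1}{2k+1}\frac{B_{2n-2k}}{k+1}F_{2k+2}(s).$$ The Lucas polynomials satisfy $$L_{2n+1}(s)=\sum_{k=0}^{n}(-1)^{n-k}\frac{T_{2n-2k+1}}{2^{2n-2k+1}}\binom{2n+1}{2k}L_{2k}(s)=\sum_{k=0}^{n}(-1)^{n-k}\frac{G_{2n-2k+2}}{2n-2k+2}\binom{2n+1}{2k}L_{2k}(s)$$ and $$L_{2n}(s)=2\sum_{j=0}^{n}\binom{2n}{2j}\frac{B_{2n-2j}}{2j+1}L_{2j+1}(s).$$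
   Context: The Fibonacci polynomials are defined by $F_0(s)=0$, $F_1(s)=1$, $F_n(s)=F_{n-1}(s)+sF_{n-2}(s)$ for $n\ge2$; the Lucas polynomials are defined by $L_0(s)=2$, $L_1(s)=1$ and the same recursion $L_n(s)=L_{n-1}(s)+sL_{n-2}(s)$. The Genocchi numbers $G_{2n}$, $n\ge1$, are defined by $\frac{2z}{1+e^z}=z+\sum_{n\ge 1}(-1)^nG_{2n}\frac{z^{2n}}{(2n)!}$; the tangent numbers $T_{2k+1}$, $k\ge0$, by $\frac{e^{2z}-1}{e^{2z}+1}=\sum_{k\ge0}(-1)^kT_{2k+1}\frac{z^{2k+1}}{(2k+1)!}$; the Bernoulli numbers by $\sum_{n\ge0}B_n\frac{z^n}{n!}=\frac{z}{e^z-1}$. *)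

theory Defs
  imports "HOL-Computational_Algebra.Computational_Algebra"
begin

fun fib_poly :: "nat \<Rightarrow> 'a::comm_ring_1 poly" where
  "fib_poly 0 = 0"
| "fib_poly (Suc 0) = 1"
| "fib_poly (Suc (Suc n)) = fib_poly (Suc n) + [:0, 1:] * fib_poly n"

fun lucas_poly :: "nat \<Rightarrow> 'a::comm_ring_1 poly" where
  "lucas_poly 0 = 2"
| "lucas_poly (Suc 0) = 1"
| "lucas_poly (Suc (Suc n)) = lucas_poly (Suc n) + [:0, 1:] * lucas_poly n"

text \<open>
  The number sequences are read off from the coefficients of their generating functions, as formal
  power series over the rationals. The index of each constant is the conventional subscript, so the
  Genocchi numbers are meaningful only at positive even arguments and the tangent numbers only at
  odd ones; the sign \<open>(-1)\<^sup>n\<close> at \<open>G\<^bsub>2n\<^esub>\<close> and \<open>(-1)\<^sup>k\<close> at \<open>T\<^bsub>2k+1\<^esub>\<close> is in both cases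
  \<open>(-1)\<close> to the power \<open>m div 2\<close>, where \<open>m\<close> is the subscript. The lemmas below
  confirm the full generating function identities, including the vanishing of the remaining
  coefficients.
\<close>

definition genocchi :: "nat \<Rightarrow> rat" where
  "genocchi m = (-1) ^ (m div 2) * fact m * fps_nth (2 * fps_X / (1 + fps_exp 1)) m"

definition tangent_number :: "nat \<Rightarrow> rat" where
  "tangent_number m =
     (-1) ^ (m div 2) * fact m * fps_nth ((fps_exp 2 - 1) / (fps_exp 2 + 1)) m"

definition bernoulli :: "nat \<Rightarrow> rat" where
  "bernoulli n = fact n * fps_nth (fps_X / (fps_exp 1 - 1)) n"

lemma bernoulli_gf:
  "Abs_fps (\<lambda>n. bernoulli n / fact n) = fps_X / (fps_exp 1 - 1)"
  by (simp add: fps_eq_iff bernoulli_def)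

lemma bernoulli_gf_mult:
  "Abs_fps (\<lambda>n. bernoulli n / fact n) * (fps_exp 1 - 1) = fps_X"
proof -
  have "fps_nth (fps_exp 1 - 1 :: rat fps) 1 \<noteq> 0" by simp
  hence "subdegree (fps_exp 1 - 1 :: rat fps) \<le> 1"
    by (rule subdegree_leI)
  moreover have "(fps_exp 1 - 1 :: rat fps) \<noteq> 0" by simp
  ultimately have "(fps_exp 1 - 1 :: rat fps) dvd fps_X"
    by (simp add: fps_dvd_iff)
  thus ?thesis unfolding bernoulli_gf by simp
qed

lemma fps_nth_compose_uminus_X:
  "fps_nth (f oo - fps_X) m = (-1) ^ m * fps_nth (f :: rat fps) m"
  by (simp add: fps_compose_uminus')

lemma genocchi_gf:
  "2 * fps_X / (1 + fps_exp 1) =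
     fps_X + Abs_fps (\<lambda>m. if even m \<and> m \<ge> 2 then (-1) ^ (m div 2) * genocchi m / fact m else 0)"
proof -
  define E where "E = (fps_exp 1 :: rat fps)"
  define A where "A = 2 * fps_X / (1 + E)"
  define A' where "A' = A oo - fps_X"
  have nz: "fps_nth (1 + E) 0 \<noteq> 0" by (simp add: E_def)
  have E': "E oo - fps_X = fps_exp (-1)" by (simp add: E_def)
  have EE: "E * fps_exp (-1) = 1"
    using fps_exp_add_mult[of "1::rat" "-1"] by (simp add: E_def)
  have A: "A * (1 + E) = 2 * fps_X"
    using nz by (simp add: A_def fps_dvd_iff)
  have "A' * (1 + fps_exp (-1)) = - (2 * fps_X)"
    using arg_cong[OF A, of "\<lambda>f. f oo - fps_X"]
    by (simp add: A'_def fps_compose_mult_distrib fps_compose_add_distrib E'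
        numeral_fps_const)
  hence "A' * (1 + fps_exp (-1)) * E = - (2 * fps_X) * E" by simp
  hence "A' * (1 + E) = - (2 * fps_X) * E"
    using EE by (simp add: algebra_simps)
  hence "(A - A') * (1 + E) = 2 * fps_X * (1 + E)"
    using A by (simp add: algebra_simps)
  moreover have "1 + E \<noteq> 0" using nz by force
  ultimately have AA: "A - A' = 2 * fps_X" by simp
  have odd: "fps_nth A m = (if m = 1 then 1 else 0)" if "odd m" for m
  proof -
    have "fps_nth A m - (-1) ^ m * fps_nth A m = fps_nth (2 * fps_X) m"
      unfolding AA[symmetric] A'_def by (simp add: fps_nth_compose_uminus_X)
    thus ?thesis using that
      by (cases "m = 0"; cases "m = 1") (simp_all add: numeral_fps_const)
  qed
  have zero: "fps_nth A 0 = 0"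
    using arg_cong[OF A, of "\<lambda>f. fps_nth f 0"] nz by simp
  have sq: "(-1) ^ k * ((-1) ^ k * x) = (x :: rat)" for k x
    by (simp flip: mult.assoc power_add)
  have "fps_nth A m = fps_nth (fps_X + Abs_fps (\<lambda>m. if even m \<and> m \<ge> 2
          then (-1) ^ (m div 2) * genocchi m / fact m else 0)) m" for m
  proof (cases "even m")
    case True
    show ?thesis
    proof (cases "m = 0")
      case False
      hence "m \<ge> 2" using True by presburger
      thus ?thesis using True
        by (simp add: genocchi_def A_def E_def mult.assoc sq)
    qed (simp add: zero)
  qed (simp add: odd)
  thus ?thesis unfolding fps_eq_iff A_def E_def by blast
qed

lemma tangent_number_gf:
  "(fps_exp 2 - 1) / (fps_exp 2 + 1) =
     Abs_fps (\<lambda>m. if odd m then (-1) ^ (m div 2) * tangent_number m / fact m else 0)"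
proof -
  define E where "E = (fps_exp 2 :: rat fps)"
  define A where "A = (E - 1) / (E + 1)"
  define A' where "A' = A oo - fps_X"
  have nz: "fps_nth (E + 1) 0 \<noteq> 0" by (simp add: E_def)
  have E': "E oo - fps_X = fps_exp (-2)" by (simp add: E_def)
  have EE: "E * fps_exp (-2) = 1"
    using fps_exp_add_mult[of "2::rat" "-2"] by (simp add: E_def)
  have "(E + 1) dvd (E - 1)" using nz by (simp add: fps_dvd_iff)
  hence A: "A * (E + 1) = E - 1"
    unfolding A_def by (rule dvd_div_mult_self)
  have "A' * (fps_exp (-2) + 1) = fps_exp (-2) - 1"
    using arg_cong[OF A, of "\<lambda>f. f oo - fps_X"]
    by (simp add: A'_def fps_compose_mult_distrib fps_compose_add_distrib
        fps_compose_sub_distrib E')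
  hence "A' * (fps_exp (-2) + 1) * E = (fps_exp (-2) - 1) * E" by simp
  hence "A' * (E + 1) = 1 - E"
    using EE by (simp add: algebra_simps)
  hence "(A + A') * (E + 1) = 0"
    using A by (simp only: distrib_right) simp
  moreover have "E + 1 \<noteq> 0" using nz by force
  ultimately have AA: "A + A' = 0" by simp
  have even: "fps_nth A m = 0" if "even m" for m
  proof -
    have "fps_nth A m + (-1) ^ m * fps_nth A m = fps_nth (0 :: rat fps) m"
      unfolding AA[symmetric] A'_def by (simp add: fps_nth_compose_uminus_X)
    thus ?thesis using that by simp
  qed
  have sq: "(-1) ^ k * ((-1) ^ k * x) = (x :: rat)" for k x
    by (simp flip: mult.assoc power_add)
  have "fps_nth A m = fps_nth (Abs_fps (\<lambda>m. if odd m
          then (-1) ^ (m div 2) * tangent_number m / fact m else 0)) m" for m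
  proof (cases "even m")
    case False
    have "tangent_number m = (-1) ^ (m div 2) * fact m * fps_nth A m"
      unfolding tangent_number_def A_def E_def ..
    with False show ?thesis by (simp add: mult.assoc sq)
  qed (simp add: even)
  thus ?thesis unfolding fps_eq_iff A_def E_def by blast
qed

end

theory Submission
  imports Defs
begin

text \<open>
  Substituting \<open>s = t (t - 1)\<close> makes the roots \<open>t\<close> and \<open>1 - t\<close> of \<open>x\<^sup>2 = x + s\<close> rational, and
  infinitely many \<open>s\<close> arise this way. As the roots add up to \<open>1\<close>, the exponential generating
  functions satisfy \<open>L(z) = e\<^sup>z L(-z)\<close> and \<open>F(z) = - e\<^sup>z F(-z)\<close>. Hence the odd part of \<open>L\<close> is
  \<open>tanh (z/2)\<close> times its even part, and for \<open>F\<close> the parts are exchanged. Multiplying by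
  \<open>tanh (z/2)\<close> and by \<open>(z/2) coth (z/2)\<close>, whose coefficients are the tangent (or Genocchi) numbers
  and the Bernoulli numbers, and comparing coefficients yields the identities.
\<close>

section \<open>Exponential generating functions, parity parts and binomial convolution\<close>

definition egf :: "(nat \<Rightarrow> rat) \<Rightarrow> rat fps" where
  "egf u = Abs_fps (\<lambda>n. u n / fact n)"

text \<open>The parity parts keep the full index range, padded with zeros, so that binomial
  convolution applies to them unchanged.\<close>

definition evens :: "(nat \<Rightarrow> rat) \<Rightarrow> nat \<Rightarrow> rat" where
  "evens u n = (if even n then u n else 0)"

definition odds :: "(nat \<Rightarrow> rat) \<Rightarrow> nat \<Rightarrow> rat" where
  "odds u n = (if odd n then u n else 0)"

definition altern :: "(nat \<Rightarrow> rat) \<Rightarrow> nat \<Rightarrow> rat" where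
  "altern u n = (-1) ^ n * u n"

lemma egf_nth [simp]: "fps_nth (egf u) n = u n / fact n"
  by (simp add: egf_def)

lemma egf_altern: "egf (altern u) = egf u oo - fps_X"
  by (simp add: fps_eq_iff fps_nth_compose_uminus_X altern_def)

lemma egf_evens: "2 * egf (evens u) = egf u + egf (altern u)"
  by (simp add: fps_eq_iff evens_def altern_def numeral_fps_const)

lemma egf_odds: "2 * egf (odds u) = egf u - egf (altern u)"
  by (simp add: fps_eq_iff odds_def altern_def numeral_fps_const)

lemma egf_mult_nth:
  "fps_nth (egf u * egf v) n * fact n = (\<Sum>i\<le>n. of_nat (n choose i) * u i * v (n - i))"
proof -
  have "fps_nth (egf u * egf v) n * fact n
      = (\<Sum>i\<le>n. u i / fact i * (v (n - i) / fact (n - i)) * fact n)"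
    by (simp add: fps_mult_nth sum_distrib_right atLeast0AtMost)
  also have "\<dots> = (\<Sum>i\<le>n. of_nat (n choose i) * u i * v (n - i))"
    by (rule sum.cong) (simp_all add: binomial_fact)
  finally show ?thesis .
qed

section \<open>The series tanh (z/2) and z coth (z/2) and their coefficients\<close>

lemma exp_plus_one_nonzero: "fps_exp 1 + 1 \<noteq> (0 :: rat fps)"
proof
  assume "fps_exp 1 + 1 = (0 :: rat fps)"
  then have "fps_nth (fps_exp 1 + 1 :: rat fps) 0 = 0" by simp
  then show False by simp
qed

lemma exp_minus_one_nonzero: "fps_exp 1 - 1 \<noteq> (0 :: rat fps)"
  by simp

lemma exp_mult_exp_minus: "fps_exp 1 * fps_exp (-1) = (1 :: rat fps)"
  using fps_exp_add_mult[of "1::rat" "-1"] by simp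

text \<open>These are the derivatives of tanh (z/2) at 0: the tangent numbers belong to tanh z, and
  halving the argument divides the m-th coefficient by 2^m.\<close>

definition half_tanh :: "nat \<Rightarrow> rat" where
  "half_tanh m = (if odd m then (-1) ^ (m div 2) * tangent_number m / 2 ^ m else 0)"

lemma half_tanh_gf: "egf half_tanh * (fps_exp 1 + 1) = fps_exp 1 - 1"
proof -
  define A where "A = ((fps_exp 2 - 1) / (fps_exp 2 + 1) :: rat fps)"
  \<comment> \<open>Composition with z/2 carries tanh z to tanh (z/2) and e^(2z) to e^z.\<close>
  define c where "c = (fps_const (1/2) * fps_X :: rat fps)"
  have "fps_nth (fps_exp 2 + 1 :: rat fps) 0 \<noteq> 0" by simp
  hence "(fps_exp 2 + 1) dvd (fps_exp 2 - 1 :: rat fps)" by (simp add: fps_dvd_iff)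
  hence A: "A * (fps_exp 2 + 1) = fps_exp 2 - 1"
    unfolding A_def by (rule dvd_div_mult_self)
  have c0: "fps_nth c 0 = 0" by (simp add: c_def)
  have e: "fps_exp 2 oo c = (fps_exp 1 :: rat fps)"
    by (simp add: c_def fps_exp_compose_linear)
  have "A oo c = egf half_tanh"
    unfolding A_def tangent_number_gf c_def fps_compose_linear
    by (simp add: fps_eq_iff half_tanh_def power_divide)
  moreover have "(A oo c) * (fps_exp 1 + 1) = fps_exp 1 - 1"
    using arg_cong[OF A, of "\<lambda>f. f oo c"] c0
    by (simp add: fps_compose_mult_distrib fps_compose_add_distrib fps_compose_sub_distrib e)
  ultimately show ?thesis by simp
qed

text \<open>Clearing the denominator in 2z/(1 + e^z) = z + G(z) gives G(z) = -z tanh (z/2), in a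
  product form from which e^z + 1 can be cancelled.\<close>

lemma genocchi_gf_mult:
  "Abs_fps (\<lambda>m. if even m \<and> m \<ge> 2 then (-1) ^ (m div 2) * genocchi m / fact m else 0)
     * (fps_exp 1 + 1) = fps_X * (1 - fps_exp 1)"
  (is "?G * _ = _")
proof -
  have "fps_nth (1 + fps_exp 1 :: rat fps) 0 \<noteq> 0" by simp
  hence "(1 + fps_exp 1) dvd (2 * fps_X :: rat fps)" by (simp add: fps_dvd_iff)
  hence "2 * fps_X / (1 + fps_exp 1) * (1 + fps_exp 1) = (2 * fps_X :: rat fps)"
    by (rule dvd_div_mult_self)
  hence "(fps_X + ?G) * (1 + fps_exp 1) = 2 * fps_X"
    unfolding genocchi_gf .
  then show ?thesis by (simp add: algebra_simps)
qed

lemma half_tanh_tangent: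
  "half_tanh (2 * j + 1) = (-1) ^ j * (tangent_number (2 * j + 1) / 2 ^ (2 * j + 1))"
  by (simp add: half_tanh_def)

text \<open>Compare coefficients at z^(2j+2) in z tanh (z/2) = -G(z): the factor z shifts the index,
  the minus sign turns (-1)^(j+1) into (-1)^j, and (2j+2)!/(2j+1)! is the denominator.\<close>

lemma half_tanh_genocchi:
  "half_tanh (2 * j + 1) = (-1) ^ j * (genocchi (2 * j + 2) / of_nat (2 * j + 2))"
proof -
  define G where "G = Abs_fps (\<lambda>m. if even m \<and> m \<ge> 2
    then (-1) ^ (m div 2) * genocchi m / fact m else 0)"
  have "(fps_X * egf half_tanh) * (fps_exp 1 + 1) = - G * (fps_exp 1 + 1)"
    unfolding mult.assoc half_tanh_gf mult_minus_left G_def genocchi_gf_mult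
    by (simp add: algebra_simps)
  hence "fps_X * egf half_tanh = - G"
    using exp_plus_one_nonzero by (metis mult_right_cancel)
  from arg_cong[OF this, of "\<lambda>f. fps_nth f (2 * j + 2)"]
  have "half_tanh (2 * j + 1) / fact (2 * j + 1) = (-1) ^ j * genocchi (2 * j + 2) / fact (2 * j + 2)"
    by (simp add: G_def)
  moreover have "fact (2 * j + 2) = (of_nat (2 * j + 2) * fact (2 * j + 1) :: rat)"
    using fact_Suc[of "2 * j + 1", where 'a = rat] by simp
  ultimately show ?thesis
    by (simp add: field_simps del: fact_Suc of_nat_add of_nat_mult of_nat_Suc)
qed

text \<open>With B(z) = z/(e^z - 1) one has B(-z) = z e^z/(e^z - 1), so B(z) + B(-z) = z coth (z/2).
  Passing to the even part discards B_1.\<close>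

lemma bernoulli_evens_gf: "2 * egf (evens bernoulli) * (fps_exp 1 - 1) = fps_X * (fps_exp 1 + 1)"
proof -
  define B where "B = egf bernoulli"
  define B' where "B' = egf (altern bernoulli)"
  have B: "B * (fps_exp 1 - 1) = fps_X"
    using bernoulli_gf_mult by (simp add: B_def egf_def)
  have "B' * (fps_exp (-1) - 1) = - fps_X"
    using arg_cong[OF B, of "\<lambda>f. f oo - fps_X"]
    by (simp add: B_def B'_def egf_altern fps_compose_mult_distrib fps_compose_sub_distrib)
  hence "B' * (fps_exp (-1) - 1) * fps_exp 1 = - fps_X * fps_exp 1" by simp
  hence "B' * (fps_exp 1 - 1) = fps_X * fps_exp 1"
    using exp_mult_exp_minus by (simp add: algebra_simps)
  with B show ?thesis
    unfolding egf_evens B_def[symmetric] B'_def[symmetric] by (simp only: distrib_left distrib_right) simp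
qed

section \<open>Passing between the parity parts by tanh (z/2) and its reciprocal\<close>

lemma half_tanh_transfer:
  assumes "egf p * (fps_exp 1 + 1) = egf q * (fps_exp 1 - 1)"
  shows "p n = (\<Sum>i\<le>n. of_nat (n choose i) * q i * half_tanh (n - i))"
proof -
  have "egf p * (fps_exp 1 + 1) = (egf q * egf half_tanh) * (fps_exp 1 + 1)"
    unfolding mult.assoc half_tanh_gf by (rule assms)
  hence "egf p = egf q * egf half_tanh"
    using exp_plus_one_nonzero by (metis mult_right_cancel)
  hence "fps_nth (egf p) n * fact n = fps_nth (egf q * egf half_tanh) n * fact n" by simp
  then show ?thesis unfolding egf_mult_nth by simp
qed

text \<open>The relation P = Q tanh (z/2) is inverted as z Q = P z coth (z/2), the last factor being
  twice the even Bernoulli series. The factor z shifts the index and so produces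
  \<open>Suc n\<close>.\<close>

lemma bernoulli_transfer:
  assumes "egf p * (fps_exp 1 + 1) = egf q * (fps_exp 1 - 1)"
  shows "of_nat (Suc n) * q n
    = 2 * (\<Sum>i\<le>Suc n. of_nat (Suc n choose i) * p i * evens bernoulli (Suc n - i))"
proof -
  have "(fps_X * egf q) * (fps_exp 1 - 1) = egf p * (fps_X * (fps_exp 1 + 1))"
    using assms by (simp add: mult.assoc mult.left_commute)
  also have "\<dots> = (2 * (egf p * egf (evens bernoulli))) * (fps_exp 1 - 1)"
    unfolding bernoulli_evens_gf[symmetric] by (simp add: mult_ac)
  finally have "fps_X * egf q = 2 * (egf p * egf (evens bernoulli))"
    using exp_minus_one_nonzero by (metis mult_right_cancel)
  hence "fps_nth (fps_X * egf q) (Suc n) * fact (Suc n)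
      = 2 * (fps_nth (egf p * egf (evens bernoulli)) (Suc n) * fact (Suc n))"
    by (simp add: numeral_fps_const mult.assoc del: fact_Suc)
  then show ?thesis
    unfolding egf_mult_nth by (simp add: mult.commute del: sum.atMost_Suc of_nat_Suc binomial_Suc_Suc)
qed

text \<open>If U(z) = e^z U(-z), then (U(z) - U(-z))(e^z + 1) and (U(z) + U(-z))(e^z - 1) both
  reduce to e^z U(z) - U(-z).\<close>

lemma even_odd_parts_symmetric:
  assumes "egf (altern u) * fps_exp 1 = egf u"
  shows "egf (odds u) * (fps_exp 1 + 1) = egf (evens u) * (fps_exp 1 - 1)"
proof -
  have "(2 * egf (odds u)) * (fps_exp 1 + 1) = (2 * egf (evens u)) * (fps_exp 1 - 1)"
    unfolding egf_odds egf_evens using assms by (simp add: algebra_simps)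
  then show ?thesis by (simp add: mult.assoc)
qed

text \<open>With U(z) = -e^z U(-z) the common value becomes e^z U(z) + U(-z), and the parts exchange
  roles.\<close>

lemma even_odd_parts_antisymmetric:
  assumes "egf (altern u) * fps_exp 1 = - egf u"
  shows "egf (evens u) * (fps_exp 1 + 1) = egf (odds u) * (fps_exp 1 - 1)"
proof -
  have "(2 * egf (evens u)) * (fps_exp 1 + 1) = (2 * egf (odds u)) * (fps_exp 1 - 1)"
    unfolding egf_odds egf_evens using assms by (simp add: algebra_simps)
  then show ?thesis by (simp add: mult.assoc)
qed

section \<open>Coefficient comparison for sequences with either symmetry\<close>

lemma symmetric_tangent:
  assumes "egf (altern u) * fps_exp 1 = egf u"
  shows "u (2 * n + 1)
    = (\<Sum>k=0..n. of_nat ((2 * n + 1) choose (2 * k)) * u (2 * k) * half_tanh (2 * (n - k) + 1))"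
proof -
  have "u (2 * n + 1) = odds u (2 * n + 1)" by (simp add: odds_def)
  also have "\<dots> = (\<Sum>i\<le>Suc (2 * n).
      of_nat (Suc (2 * n) choose i) * evens u i * half_tanh (Suc (2 * n) - i))"
    using half_tanh_transfer[OF even_odd_parts_symmetric[OF assms], of "Suc (2 * n)"] by simp
  \<comment> \<open>Indices are grouped as 2k, 2k+1, and \<open>evens u\<close> kills the odd one.
    \<open>half_tanh\<close> stays in the result so that it can be read in tangent or in Genocchi
    form.\<close>
  also have "\<dots> = (\<Sum>k\<le>n. of_nat (Suc (2 * n) choose (2 * k)) * u (2 * k)
      * half_tanh (Suc (2 * n) - 2 * k))"
    by (simp only: sum.in_pairs_0) (simp add: evens_def)
  also have "\<dots> = (\<Sum>k=0..n. of_nat ((2 * n + 1) choose (2 * k)) * u (2 * k)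
      * half_tanh (2 * (n - k) + 1))"
    unfolding atLeast0AtMost by (rule sum.cong) (simp_all add: Suc_diff_le diff_mult_distrib2)
  finally show ?thesis .
qed

text \<open>The factor 2n+1 from the index shift is cancelled by absorption in the binomials, which
  leaves the division by 2j+1.\<close>

lemma symmetric_bernoulli:
  assumes "egf (altern u) * fps_exp 1 = egf u"
  shows "u (2 * n) = 2 * (\<Sum>j=0..n. of_nat ((2 * n) choose (2 * j))
    * (bernoulli (2 * n - 2 * j) / of_nat (2 * j + 1)) * u (2 * j + 1))"
proof -
  have "of_nat (Suc (2 * n)) * u (2 * n) = of_nat (Suc (2 * n)) * evens u (2 * n)"
    by (simp add: evens_def)
  also have "\<dots> = 2 * (\<Sum>i\<le>Suc (2 * n).
      of_nat (Suc (2 * n) choose i) * odds u i * evens bernoulli (Suc (2 * n) - i))"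
    by (rule bernoulli_transfer[OF even_odd_parts_symmetric[OF assms]])
  also have "\<dots> = 2 * (\<Sum>j\<le>n. of_nat (Suc (2 * n) choose Suc (2 * j)) * u (Suc (2 * j))
      * bernoulli (2 * n - 2 * j))"
    by (simp only: sum.in_pairs_0) (simp add: evens_def odds_def)
  also have "\<dots> = of_nat (Suc (2 * n)) * (2 * (\<Sum>j=0..n. of_nat ((2 * n) choose (2 * j))
    * (bernoulli (2 * n - 2 * j) / of_nat (2 * j + 1)) * u (2 * j + 1)))"
    unfolding atLeast0AtMost sum_distrib_left
  proof (rule sum.cong)
    fix j
    have "of_nat (Suc (2 * j)) * (of_nat (Suc (2 * n) choose Suc (2 * j)) :: rat)
        = of_nat (Suc (2 * n)) * of_nat ((2 * n) choose (2 * j))"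
      unfolding of_nat_mult[symmetric] Suc_times_binomial_eq by (simp add: mult.commute)
    then have "(of_nat (Suc (2 * n) choose Suc (2 * j)) :: rat)
        = of_nat (Suc (2 * n)) * of_nat ((2 * n) choose (2 * j)) / of_nat (Suc (2 * j))"
      by (simp add: field_simps del: binomial_Suc_Suc of_nat_Suc)
    then show "2 * (of_nat (Suc (2 * n) choose Suc (2 * j)) * u (Suc (2 * j))
        * bernoulli (2 * n - 2 * j))
      = of_nat (Suc (2 * n)) * (2 * (of_nat ((2 * n) choose (2 * j))
        * (bernoulli (2 * n - 2 * j) / of_nat (2 * j + 1)) * u (2 * j + 1)))"
      by (simp del: binomial_Suc_Suc of_nat_Suc)
  qed simp
  finally show ?thesis
    by (simp del: of_nat_Suc)
qed

text \<open>The Genocchi form of tanh (z/2) has the denominator 2n-2k+2; the ratio of neighbouring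
  binomials trades it for 2k+1 and lowers the bottom index from 2k+1 to 2k.\<close>

lemma antisymmetric_genocchi:
  assumes "egf (altern u) * fps_exp 1 = - egf u"
  shows "u (2 * n + 2) = (\<Sum>k=0..n. (-1) ^ (n - k) * (genocchi (2 * n - 2 * k + 2) / of_nat (2 * k + 1))
    * of_nat ((2 * n + 2) choose (2 * k)) * u (2 * k + 1))"
proof -
  have "u (2 * n + 2) = evens u (2 * n + 2)" by (simp add: evens_def)
  also have "\<dots> = (\<Sum>i\<le>Suc (Suc (2 * n)).
      of_nat (Suc (Suc (2 * n)) choose i) * odds u i * half_tanh (Suc (Suc (2 * n)) - i))"
    using half_tanh_transfer[OF even_odd_parts_antisymmetric[OF assms], of "Suc (Suc (2 * n))"]
    by simp
  \<comment> \<open>The number of indices is odd, so the last one, 2n+2, is split off before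
    pairing; \<open>odds u\<close> vanishes there.\<close>
  also have "\<dots> = (\<Sum>k\<le>n. of_nat (Suc (Suc (2 * n)) choose Suc (2 * k)) * u (Suc (2 * k))
      * half_tanh (Suc (2 * n) - 2 * k))"
    by (subst sum.atMost_Suc, simp only: sum.in_pairs_0) (simp add: odds_def)
  also have "\<dots> = (\<Sum>k=0..n. (-1) ^ (n - k) * (genocchi (2 * n - 2 * k + 2) / of_nat (2 * k + 1))
    * of_nat ((2 * n + 2) choose (2 * k)) * u (2 * k + 1))"
    unfolding atLeast0AtMost
  proof (rule sum.cong)
    fix k assume "k \<in> {..n}"
    then have k: "k \<le> n" by simp
    \<comment> \<open>Both sides equal (2n+2) times the binomial of 2n+1 over 2k.\<close>
    have "Suc (2 * k) * ((2 * n + 2) choose Suc (2 * k))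
        = (2 * (n - k) + 2) * ((2 * n + 2) choose (2 * k))"
      using binomial_absorb_comp[of "2 * n + 2" "2 * k"] binomial_absorption[of "2 * k" "2 * n + 2"] k
      by (simp add: diff_mult_distrib2 Suc_diff_le del: binomial_Suc_Suc)
    then have "of_nat (Suc (2 * k)) * (of_nat ((2 * n + 2) choose Suc (2 * k)) :: rat)
        = of_nat (2 * (n - k) + 2) * of_nat ((2 * n + 2) choose (2 * k))"
      unfolding of_nat_mult[symmetric] by (simp only:)
    then have quot: "(of_nat ((2 * n + 2) choose Suc (2 * k)) :: rat) / of_nat (2 * (n - k) + 2)
        = of_nat ((2 * n + 2) choose (2 * k)) / of_nat (2 * k + 1)"
      by (simp add: frac_eq_eq mult.commute del: binomial_Suc_Suc of_nat_Suc of_nat_add of_nat_mult)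
    have tanh: "half_tanh (Suc (2 * n) - 2 * k)
        = (-1) ^ (n - k) * (genocchi (2 * n - 2 * k + 2) / of_nat (2 * (n - k) + 2))"
      using half_tanh_genocchi[of "n - k"] k by (simp add: Suc_diff_le diff_mult_distrib2)
    have "of_nat ((2 * n + 2) choose Suc (2 * k)) * u (Suc (2 * k)) * half_tanh (Suc (2 * n) - 2 * k)
        = (-1) ^ (n - k) * genocchi (2 * n - 2 * k + 2) * u (Suc (2 * k))
          * (of_nat ((2 * n + 2) choose Suc (2 * k)) / of_nat (2 * (n - k) + 2))"
      unfolding tanh by (simp only: mult_ac divide_inverse)
    also have "\<dots> = (-1) ^ (n - k) * (genocchi (2 * n - 2 * k + 2) / of_nat (2 * k + 1))
          * of_nat ((2 * n + 2) choose (2 * k)) * u (2 * k + 1)"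
      unfolding quot by (simp only: mult_ac divide_inverse Suc_eq_plus1)
    finally show "of_nat (Suc (Suc (2 * n)) choose Suc (2 * k)) * u (Suc (2 * k))
          * half_tanh (Suc (2 * n) - 2 * k)
        = (-1) ^ (n - k) * (genocchi (2 * n - 2 * k + 2) / of_nat (2 * k + 1))
          * of_nat ((2 * n + 2) choose (2 * k)) * u (2 * k + 1)"
      by (simp del: binomial_Suc_Suc)
  qed simp
  finally show ?thesis .
qed

lemma antisymmetric_bernoulli:
  assumes "egf (altern u) * fps_exp 1 = - egf u"
  shows "u (2 * n + 1) = (\<Sum>k=0..n. of_nat ((2 * n + 1) choose (2 * k + 1))
    * (bernoulli (2 * n - 2 * k) / of_nat (k + 1)) * u (2 * k + 2))"
proof -
  \<comment> \<open>At z = 0 the antisymmetry reads u 0 = -u 0. This removes the index-0 term, which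
    would carry B_(2n+2).\<close>
  have "u 0 = 0"
    using arg_cong[OF assms, of "\<lambda>f. fps_nth f 0"] by (simp add: altern_def)
  have "of_nat (2 * n + 2) * u (2 * n + 1) = of_nat (Suc (Suc (2 * n))) * odds u (Suc (2 * n))"
    by (simp add: odds_def)
  also have "\<dots> = 2 * (\<Sum>i\<le>Suc (Suc (2 * n)).
      of_nat (Suc (Suc (2 * n)) choose i) * evens u i * evens bernoulli (Suc (Suc (2 * n)) - i))"
    by (rule bernoulli_transfer[OF even_odd_parts_antisymmetric[OF assms]])
  \<comment> \<open>Splitting off index 0 shifts the pairing to 2k+1, 2k+2, of which only the second
    survives.\<close>
  also have "\<dots> = 2 * (\<Sum>k\<le>n. of_nat (Suc (Suc (2 * n)) choose Suc (Suc (2 * k)))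
      * u (Suc (Suc (2 * k))) * bernoulli (2 * n - 2 * k))"
    by (subst sum.atMost_Suc_shift, simp only: sum.in_pairs_0)
       (simp add: evens_def \<open>u 0 = 0\<close> del: binomial_Suc_Suc)
  also have "\<dots> = of_nat (2 * n + 2) * (\<Sum>k=0..n. of_nat ((2 * n + 1) choose (2 * k + 1))
    * (bernoulli (2 * n - 2 * k) / of_nat (k + 1)) * u (2 * k + 2))"
    unfolding atLeast0AtMost sum_distrib_left
  proof (rule sum.cong)
    fix k
    have "of_nat (Suc (Suc (2 * k))) * (of_nat (Suc (Suc (2 * n)) choose Suc (Suc (2 * k))) :: rat)
        = of_nat (2 * n + 2) * of_nat ((2 * n + 1) choose (2 * k + 1))"
      using Suc_times_binomial_eq[of "2 * n + 1" "2 * k + 1"]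
      unfolding of_nat_mult[symmetric] by (simp add: mult.commute del: binomial_Suc_Suc)
    \<comment> \<open>Absorption divides by 2k+2 = 2(k+1); the leading 2 cancels, leaving k+1 as the
      denominator.\<close>
    moreover have "of_nat (Suc (Suc (2 * k))) = (2 * of_nat (k + 1) :: rat)" by simp
    ultimately have "2 * (of_nat (Suc (Suc (2 * n)) choose Suc (Suc (2 * k))) :: rat)
        = of_nat (2 * n + 2) * of_nat ((2 * n + 1) choose (2 * k + 1)) / of_nat (k + 1)"
      by (simp add: field_simps del: binomial_Suc_Suc of_nat_Suc of_nat_add of_nat_mult)
    then show "2 * (of_nat (Suc (Suc (2 * n)) choose Suc (Suc (2 * k)))
        * u (Suc (Suc (2 * k))) * bernoulli (2 * n - 2 * k))
      = of_nat (2 * n + 2) * (of_nat ((2 * n + 1) choose (2 * k + 1))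
        * (bernoulli (2 * n - 2 * k) / of_nat (k + 1)) * u (2 * k + 2))"
      by (simp add: mult.assoc[symmetric] del: binomial_Suc_Suc of_nat_Suc of_nat_add of_nat_mult)
  qed simp
  finally show ?thesis
    by (simp del: of_nat_Suc of_nat_add of_nat_mult)
qed

section \<open>Binet formulas at s = t(t-1) and the resulting symmetries\<close>

lemma poly_lucas_poly: "poly (lucas_poly n) (t * (t - 1)) = t ^ n + (1 - t :: rat) ^ n"
  by (induction n rule: lucas_poly.induct) (simp_all add: algebra_simps)

text \<open>The root difference 2t-1 is kept as a factor, so that the formula also covers the double
  root t = 1/2.\<close>

lemma poly_fib_poly: "(2 * t - 1) * poly (fib_poly n) (t * (t - 1)) = t ^ n - (1 - t :: rat) ^ n"
proof (induction n rule: fib_poly.induct)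
  case (3 n)
  have "(2 * t - 1) * poly (fib_poly (Suc (Suc n))) (t * (t - 1))
      = (2 * t - 1) * poly (fib_poly (Suc n)) (t * (t - 1))
        + t * (t - 1) * ((2 * t - 1) * poly (fib_poly n) (t * (t - 1)))"
    by (simp add: algebra_simps)
  \<comment> \<open>Both roots satisfy x^2 = x + t(t-1), so their powers obey the same
    recursion.\<close>
  also have "\<dots> = t ^ Suc (Suc n) - (1 - t) ^ Suc (Suc n)"
    unfolding 3 by (simp add: algebra_simps)
  finally show ?case .
qed simp_all

text \<open>The generating function is e^(tz) + e^((1-t)z); after replacing z by -z, multiplication
  by e^z exchanges the two exponentials.\<close>

lemma lucas_symmetric:
  fixes t :: rat
  defines "u \<equiv> \<lambda>n. poly (lucas_poly n) (t * (t - 1))"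
  shows "egf (altern u) * fps_exp 1 = egf u"
proof -
  have u: "egf u = fps_exp t + fps_exp (1 - t)"
    by (simp add: u_def poly_lucas_poly fps_eq_iff add_divide_distrib)
  have "egf (altern u) = fps_exp (- t) + fps_exp (t - 1)"
    unfolding egf_altern u by (simp add: fps_compose_add_distrib)
  then show ?thesis
    by (simp add: u distrib_right fps_exp_add_mult[symmetric])
qed

text \<open>The same exchange reverses the sign of e^(tz) - e^((1-t)z), which is 2t-1 times the
  generating function; t \<noteq> 1/2 allows that constant to be cancelled.\<close>

lemma fib_antisymmetric:
  fixes t :: rat
  assumes t: "2 * t - 1 \<noteq> 0"
  defines "u \<equiv> \<lambda>n. poly (fib_poly n) (t * (t - 1))"
  shows "egf (altern u) * fps_exp 1 = - egf u"
proof -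
  define c where "c = fps_const (2 * t - 1)"
  have u: "c * egf u = fps_exp t - fps_exp (1 - t)"
    by (simp add: c_def u_def fps_eq_iff poly_fib_poly diff_divide_distrib)
  have "c * egf (altern u) = c * egf u oo - fps_X"
    by (simp add: egf_altern c_def fps_compose_mult_distrib)
  then have "c * egf (altern u) = fps_exp (- t) - fps_exp (t - 1)"
    unfolding u by (simp add: fps_compose_sub_distrib)
  then have "c * egf (altern u) * fps_exp 1 = c * (- egf u)"
    by (simp add: u left_diff_distrib fps_exp_add_mult[symmetric])
  then have "c * (egf (altern u) * fps_exp 1) = c * (- egf u)"
    by (simp only: mult.assoc)
  moreover have "c \<noteq> 0" using t by (simp add: c_def)
  ultimately show ?thesis by (metis mult_left_cancel)
qed

text \<open>Multiplying the difference by 2t-1 takes care of t = 1/2, so the product vanishes at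
  every rational and is the zero polynomial. The factor cancels, and composition with the
  nonconstant x^2 - x sends no nonzero polynomial to 0.\<close>

lemma poly_eqI_parametrized:
  fixes p q :: "rat poly"
  assumes "\<And>t. 2 * t - 1 \<noteq> 0 \<Longrightarrow> poly p (t * (t - 1)) = poly q (t * (t - 1))"
  shows "p = q"
proof -
  define r :: "rat poly" where "r = [:0, -1, 1:]"
  have "poly ([:-1, 2:] * pcompose (p - q) r) t = poly 0 t" for t
  proof -
    have "(2 * t - 1) * (poly p (t * (t - 1)) - poly q (t * (t - 1))) = 0"
      using assms[of t] by auto
    then show ?thesis
      by (simp add: r_def poly_pcompose algebra_simps)
  qed
  then have "[:-1, 2:] * pcompose (p - q) r = 0"
    by (intro poly_eq_poly_eq_iff[THEN iffD1] ext)
  then have "pcompose (p - q) r = 0"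
    by (simp only: mult_eq_0_iff) simp
  then show ?thesis
    using pcompose_eq_0[of "p - q" r] by (simp add: r_def)
qed

section \<open>Polynomial identities recovered from their values at s = t(t-1)\<close>

theorem theorem2p1:
  fixes n :: nat
  shows "(fib_poly (2 * n + 2) :: rat poly) =
           (\<Sum>k = 0..n. smult ((-1) ^ (n - k) * (genocchi (2 * n - 2 * k + 2) / of_nat (2 * k + 1))
              * of_nat ((2 * n + 2) choose (2 * k))) (fib_poly (2 * k + 1))) \<and>
         (fib_poly (2 * n + 1) :: rat poly) =
           (\<Sum>k = 0..n. smult (of_nat ((2 * n + 1) choose (2 * k + 1))
              * (bernoulli (2 * n - 2 * k) / of_nat (k + 1))) (fib_poly (2 * k + 2))) \<and>
         (lucas_poly (2 * n + 1) :: rat poly) =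
           (\<Sum>k = 0..n. smult ((-1) ^ (n - k)
              * (tangent_number (2 * n - 2 * k + 1) / 2 ^ (2 * n - 2 * k + 1))
              * of_nat ((2 * n + 1) choose (2 * k))) (lucas_poly (2 * k))) \<and>
         (\<Sum>k = 0..n. smult ((-1) ^ (n - k)
              * (tangent_number (2 * n - 2 * k + 1) / 2 ^ (2 * n - 2 * k + 1))
              * of_nat ((2 * n + 1) choose (2 * k))) (lucas_poly (2 * k) :: rat poly)) =
           (\<Sum>k = 0..n. smult ((-1) ^ (n - k)
              * (genocchi (2 * n - 2 * k + 2) / of_nat (2 * n - 2 * k + 2))
              * of_nat ((2 * n + 1) choose (2 * k))) (lucas_poly (2 * k))) \<and>
         (lucas_poly (2 * n) :: rat poly) =
           2 * (\<Sum>j = 0..n. smult (of_nat ((2 * n) choose (2 * j))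
              * (bernoulli (2 * n - 2 * j) / of_nat (2 * j + 1))) (lucas_poly (2 * j + 1)))"
proof (intro conjI)
  show "(fib_poly (2 * n + 2) :: rat poly) =
           (\<Sum>k = 0..n. smult ((-1) ^ (n - k) * (genocchi (2 * n - 2 * k + 2) / of_nat (2 * k + 1))
              * of_nat ((2 * n + 2) choose (2 * k))) (fib_poly (2 * k + 1)))"
    by (rule poly_eqI_parametrized)
       (use antisymmetric_genocchi[OF fib_antisymmetric] in \<open>simp only: poly_sum poly_smult\<close>)
  show "(fib_poly (2 * n + 1) :: rat poly) =
           (\<Sum>k = 0..n. smult (of_nat ((2 * n + 1) choose (2 * k + 1))
              * (bernoulli (2 * n - 2 * k) / of_nat (k + 1))) (fib_poly (2 * k + 2)))"
    by (rule poly_eqI_parametrized)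
       (use antisymmetric_bernoulli[OF fib_antisymmetric] in \<open>simp only: poly_sum poly_smult\<close>)
  \<comment> \<open>Tangent and Genocchi numbers express the same coefficient of tanh (z/2), so the
    two Lucas sums agree term by term.\<close>
  have eq: "half_tanh (2 * (n - k) + 1) =
      (-1) ^ (n - k) * (tangent_number (2 * n - 2 * k + 1) / 2 ^ (2 * n - 2 * k + 1))"
    "half_tanh (2 * (n - k) + 1) =
      (-1) ^ (n - k) * (genocchi (2 * n - 2 * k + 2) / of_nat (2 * n - 2 * k + 2))" for k
    using half_tanh_tangent[of "n - k"] half_tanh_genocchi[of "n - k"]
    by (simp_all only: diff_mult_distrib2)
  show "(lucas_poly (2 * n + 1) :: rat poly) =
           (\<Sum>k = 0..n. smult ((-1) ^ (n - k)
              * (tangent_number (2 * n - 2 * k + 1) / 2 ^ (2 * n - 2 * k + 1))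
              * of_nat ((2 * n + 1) choose (2 * k))) (lucas_poly (2 * k)))"
    unfolding eq(1)[symmetric]
    by (rule poly_eqI_parametrized)
       (use symmetric_tangent[OF lucas_symmetric] in \<open>simp only: poly_sum poly_smult mult_ac\<close>)
  show "(\<Sum>k = 0..n. smult ((-1) ^ (n - k)
              * (tangent_number (2 * n - 2 * k + 1) / 2 ^ (2 * n - 2 * k + 1))
              * of_nat ((2 * n + 1) choose (2 * k))) (lucas_poly (2 * k) :: rat poly)) =
           (\<Sum>k = 0..n. smult ((-1) ^ (n - k)
              * (genocchi (2 * n - 2 * k + 2) / of_nat (2 * n - 2 * k + 2))
              * of_nat ((2 * n + 1) choose (2 * k))) (lucas_poly (2 * k)))"
    unfolding eq(1)[symmetric] eq(2)[symmetric] ..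
  show "(lucas_poly (2 * n) :: rat poly) =
           2 * (\<Sum>j = 0..n. smult (of_nat ((2 * n) choose (2 * j))
              * (bernoulli (2 * n - 2 * j) / of_nat (2 * j + 1))) (lucas_poly (2 * j + 1)))"
    by (rule poly_eqI_parametrized)
       (use symmetric_bernoulli[OF lucas_symmetric] in
          \<open>simp only: poly_sum poly_smult poly_mult poly_numeral\<close>)
qed

end
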